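(* Let $E$ be a $\mathsf{TO(TO{+}OB)}$ set of permutations. Then either there exists $N$ such that $E$ contains every permutation whose support has size at least $N$, or there is a bound on the size of the support of the permutations in $E$.
   Context: $\mathsf{TOTO}$: a permutation $\sigma$ of size $n$ is viewed as the structure with domain $\{(i,\sigma(i)) : 1\le i\le n\}$ and two strict total orders $<_P$ (comparing first coordinates) and $<_V$ (comparing second coordinates); $\mathsf{TOTO}$ sentences are first-order sentences (with equality) over the signature $\{<_P,<_V\}$. $\mathsf{TOOB}$: the same permutation is viewed as the structure with domain $\{1,\dots,n\}$ and one binary relation $R$ with $iRj$ iff $\sigma(i)=j$; $\mathsf{TOOB}$ sentences are first-order sentences (with equality) over the signature $\{R\}$. A set $E$ of permutations (of all sizes) is a $\mathsf{TO(TO{+}OB)}$ set if there exist a $\mathsf{TOTO}$ sentence and a $\mathsf{TOOB}$ sentence each of whose sets of permutation models is exactly $E$. The support of a permutation is its set of non-fixed points. *)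

theory Defs
  imports "HOL-Combinatorics.Permutations"
begin

text \<open>Variables are natural numbers and \<open>'r\<close> is the type of relation symbols, all of
  which are binary. The only terms are variables.\<close>

datatype 'r fo =
    FEq nat nat
  | FRel 'r nat nat
  | FNot "'r fo"
  | FAnd "'r fo" "'r fo"
  | FOr "'r fo" "'r fo"
  | FEx nat "'r fo"
  | FAll nat "'r fo"

primrec free_vars :: "'r fo \<Rightarrow> nat set" where
  "free_vars (FEq x y) = {x, y}"
| "free_vars (FRel r x y) = {x, y}"
| "free_vars (FNot \<phi>) = free_vars \<phi>"
| "free_vars (FAnd \<phi> \<psi>) = free_vars \<phi> \<union> free_vars \<psi>"
| "free_vars (FOr \<phi> \<psi>) = free_vars \<phi> \<union> free_vars \<psi>"
| "free_vars (FEx x \<phi>) = free_vars \<phi> - {x}"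
| "free_vars (FAll x \<phi>) = free_vars \<phi> - {x}"

definition sentence :: "'r fo \<Rightarrow> bool" where
  "sentence \<phi> \<longleftrightarrow> free_vars \<phi> = {}"

primrec sat :: "'a set \<Rightarrow> ('r \<Rightarrow> 'a \<Rightarrow> 'a \<Rightarrow> bool) \<Rightarrow> (nat \<Rightarrow> 'a) \<Rightarrow> 'r fo \<Rightarrow> bool" where
  "sat D I v (FEq x y) \<longleftrightarrow> v x = v y"
| "sat D I v (FRel r x y) \<longleftrightarrow> I r (v x) (v y)"
| "sat D I v (FNot \<phi>) \<longleftrightarrow> \<not> sat D I v \<phi>"
| "sat D I v (FAnd \<phi> \<psi>) \<longleftrightarrow> sat D I v \<phi> \<and> sat D I v \<psi>"
| "sat D I v (FOr \<phi> \<psi>) \<longleftrightarrow> sat D I v \<phi> \<or> sat D I v \<psi>"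
| "sat D I v (FEx x \<phi>) \<longleftrightarrow> (\<exists>a\<in>D. sat D I (v(x := a)) \<phi>)"
| "sat D I v (FAll x \<phi>) \<longleftrightarrow> (\<forall>a\<in>D. sat D I (v(x := a)) \<phi>)"

lemma sat_cong_free_vars:
  "(\<And>x. x \<in> free_vars \<phi> \<Longrightarrow> v x = w x) \<Longrightarrow> sat D I v \<phi> \<longleftrightarrow> sat D I w \<phi>"
proof (induction \<phi> arbitrary: v w)
  case (FNot \<phi>)
  then show ?case by (metis free_vars.simps(3) sat.simps(3))
next
  case (FAnd \<phi> \<psi>)
  then show ?case by (metis UnCI free_vars.simps(4) sat.simps(4))
next
  case (FOr \<phi> \<psi>)
  then show ?case by (metis UnCI free_vars.simps(5) sat.simps(5))
next
  case (FEx x \<phi>)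
  have "sat D I (v(x := a)) \<phi> \<longleftrightarrow> sat D I (w(x := a)) \<phi>" for a
    by (rule FEx.IH) (use FEx.prems in auto)
  then show ?case by simp
next
  case (FAll x \<phi>)
  have "sat D I (v(x := a)) \<phi> \<longleftrightarrow> sat D I (w(x := a)) \<phi>" for a
    by (rule FAll.IH) (use FAll.prems in auto)
  then show ?case by simp
qed simp_all

text \<open>Truth of a sentence does not depend on the valuation. The valuation is deliberately
  not required to take its values in \<open>D\<close>, so that the quantification below is never
  vacuous, even for an empty domain.\<close>

definition models :: "'a set \<Rightarrow> ('r \<Rightarrow> 'a \<Rightarrow> 'a \<Rightarrow> bool) \<Rightarrow> 'r fo \<Rightarrow> bool" where
  "models D I \<phi> \<longleftrightarrow> (\<forall>v. sat D I v \<phi>)"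

lemma models_iff_sat: "sentence \<phi> \<Longrightarrow> models D I \<phi> \<longleftrightarrow> sat D I v \<phi>"
proof -
  assume "sentence \<phi>"
  then have "sat D I w \<phi> \<longleftrightarrow> sat D I v \<phi>" for w
    by (intro sat_cong_free_vars) (simp add: sentence_def)
  then show ?thesis unfolding models_def by blast
qed

text \<open>The size has to be recorded: as functions on \<open>nat\<close>, a permutation of \<open>{1..n}\<close> and its
  extensions by fixed points coincide, but they are different permutations. The size may
  be \<open>0\<close>.\<close>

type_synonym sized_perm = "nat \<times> (nat \<Rightarrow> nat)"

definition perms :: "sized_perm set" where
  "perms = {(n, \<sigma>). \<sigma> permutes {1..n}}"

definition perm_support :: "sized_perm \<Rightarrow> nat set" where
  "perm_support = (\<lambda>(n, \<sigma>). {i \<in> {1..n}. \<sigma> i \<noteq> i})"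

datatype toto_sym = LessP | LessV

definition toto_dom :: "sized_perm \<Rightarrow> (nat \<times> nat) set" where
  "toto_dom = (\<lambda>(n, \<sigma>). {(i, \<sigma> i) | i. 1 \<le> i \<and> i \<le> n})"

primrec toto_interp :: "toto_sym \<Rightarrow> nat \<times> nat \<Rightarrow> nat \<times> nat \<Rightarrow> bool" where
  "toto_interp LessP a b \<longleftrightarrow> fst a < fst b"
| "toto_interp LessV a b \<longleftrightarrow> snd a < snd b"

definition toto_models :: "toto_sym fo \<Rightarrow> sized_perm set" where
  "toto_models \<phi> = {\<pi> \<in> perms. models (toto_dom \<pi>) toto_interp \<phi>}"

datatype toob_sym = RelR

definition toob_dom :: "sized_perm \<Rightarrow> nat set" where
  "toob_dom = (\<lambda>(n, \<sigma>). {1..n})"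

primrec toob_interp :: "sized_perm \<Rightarrow> toob_sym \<Rightarrow> nat \<Rightarrow> nat \<Rightarrow> bool" where
  "toob_interp \<pi> RelR i j \<longleftrightarrow> snd \<pi> i = j"

definition toob_models :: "toob_sym fo \<Rightarrow> sized_perm set" where
  "toob_models \<psi> = {\<pi> \<in> perms. models (toob_dom \<pi>) (toob_interp \<pi>) \<psi>}"

definition to_toto_toob_set :: "sized_perm set \<Rightarrow> bool" where
  "to_toto_toob_set E \<longleftrightarrow>
     (\<exists>\<phi> \<psi>. sentence \<phi> \<and> sentence \<psi> \<and> toto_models \<phi> = E \<and> toob_models \<psi> = E)"

end

theory Submission
  imports Defs
begin

text \<open>Of definability in \<open>TOOB\<close> only invariance under conjugation is used. Up to conjugation and
  up to \<open>TOTO\<close> sentences of quantifier depth \<open>k\<close>, all permutations of large support are equivalent,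
  by the following moves. Put \<open>K = 2 ^ k\<close>. An Ehrenfeucht-Fraisse argument shows that \<open>TOTO\<close>
  sentences of depth \<open>k\<close> do not see a change of the length of a monotone block, as long as it stays
  at least \<open>K\<close>. A rotation of \<open>n\<close> points by \<open>b\<close> consists of two such blocks, of lengths \<open>n - b\<close> and
  \<open>b\<close>, so all rotations with \<open>b \<ge> K\<close> and \<open>n - b \<ge> K\<close> are equivalent. As \<open>M\<close> cycles of length \<open>l\<close> are
  conjugate to the rotation of \<open>l * M\<close> points by \<open>M\<close>, and long cycles to rotations by \<open>1\<close>, a
  permutation of large support is equivalent to the direct sum of some permutation and a rotation.
  The rotation then absorbs the other cycles one by one: a cycle of length \<open>l \<ge> 2\<close> because \<open>K\<close> and
  \<open>K + 1\<close> cycles of length \<open>l\<close> give equivalent rotations, and a fixed point because the decreasing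
  permutations of sizes \<open>2 * K\<close> and \<open>2 * K + 1\<close> are equivalent. What remains is the rotation of
  \<open>2 * K\<close> points by \<open>K\<close>.\<close>

section \<open>Back-and-forth systems\<close>

primrec qdepth :: "'r fo \<Rightarrow> nat" where
  "qdepth (FEq x y) = 0"
| "qdepth (FRel r x y) = 0"
| "qdepth (FNot \<phi>) = qdepth \<phi>"
| "qdepth (FAnd \<phi> \<psi>) = max (qdepth \<phi>) (qdepth \<psi>)"
| "qdepth (FOr \<phi> \<psi>) = max (qdepth \<phi>) (qdepth \<psi>)"
| "qdepth (FEx x \<phi>) = Suc (qdepth \<phi>)"
| "qdepth (FAll x \<phi>) = Suc (qdepth \<phi>)"

text \<open>Read \<open>Z k V v w\<close> as: with the variables of \<open>V\<close> placed by
  \<open>v\<close> and \<open>w\<close>, the second player of the Ehrenfeucht-Fraisse game survives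
  \<open>k\<close> more rounds. Each quantifier costs one round; rebinding a variable overwrites its
  old value.\<close>

lemma sat_back_and_forth:
  fixes Z :: "nat \<Rightarrow> nat set \<Rightarrow> (nat \<Rightarrow> 'a) \<Rightarrow> (nat \<Rightarrow> 'b) \<Rightarrow> bool"
  assumes eq: "\<And>k V v w x y. Z k V v w \<Longrightarrow> x \<in> V \<Longrightarrow> y \<in> V \<Longrightarrow> v x = v y \<longleftrightarrow> w x = w y"
    and rel: "\<And>k V v w x y r. Z k V v w \<Longrightarrow> x \<in> V \<Longrightarrow> y \<in> V \<Longrightarrow>
      I r (v x) (v y) \<longleftrightarrow> J r (w x) (w y)"
    and forward: "\<And>k V v w x a. Z (Suc k) V v w \<Longrightarrow> a \<in> A \<Longrightarrow>
      \<exists>b\<in>B. Z k (insert x V) (v(x := a)) (w(x := b))"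
    and backward: "\<And>k V v w x b. Z (Suc k) V v w \<Longrightarrow> b \<in> B \<Longrightarrow>
      \<exists>a\<in>A. Z k (insert x V) (v(x := a)) (w(x := b))"
  shows "qdepth \<phi> \<le> k \<Longrightarrow> free_vars \<phi> \<subseteq> V \<Longrightarrow> Z k V v w \<Longrightarrow>
    sat A I v \<phi> \<longleftrightarrow> sat B J w \<phi>"
proof (induction \<phi> arbitrary: k V v w)
  case (FEq x y)
  then show ?case using eq by simp
next
  case (FRel r x y)
  then show ?case using rel by simp
next
  case (FNot \<phi>)
  then show ?case by (metis free_vars.simps(3) qdepth.simps(3) sat.simps(3))
next
  case (FAnd \<phi> \<psi>)
  have "sat A I v \<phi> \<longleftrightarrow> sat B J w \<phi>" "sat A I v \<psi> \<longleftrightarrow> sat B J w \<psi>"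
    using FAnd.prems FAnd.IH[of k V v w] by auto
  then show ?case by simp
next
  case (FOr \<phi> \<psi>)
  have "sat A I v \<phi> \<longleftrightarrow> sat B J w \<phi>" "sat A I v \<psi> \<longleftrightarrow> sat B J w \<psi>"
    using FOr.prems FOr.IH[of k V v w] by auto
  then show ?case by simp
next
  case (FEx x \<phi>)
  then obtain k' where k: "k = Suc k'" "qdepth \<phi> \<le> k'"
    by (cases k) auto
  have V: "free_vars \<phi> \<subseteq> insert x V" using FEx.prems by auto
  have "Z (Suc k') V v w" using FEx.prems k by simp
  then show ?case
    using forward[of k' V v w _ x] backward[of k' V v w _ x] FEx.IH[OF k(2) V]
    unfolding sat.simps by meson
next
  case (FAll x \<phi>)
  then obtain k' where k: "k = Suc k'" "qdepth \<phi> \<le> k'"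
    by (cases k) auto
  have V: "free_vars \<phi> \<subseteq> insert x V" using FAll.prems by auto
  have "Z (Suc k') V v w" using FAll.prems k by simp
  then show ?case
    using forward[of k' V v w _ x] backward[of k' V v w _ x] FAll.IH[OF k(2) V]
    unfolding sat.simps by meson
qed

lemma models_back_and_forth:
  fixes Z :: "nat \<Rightarrow> nat set \<Rightarrow> (nat \<Rightarrow> 'a) \<Rightarrow> (nat \<Rightarrow> 'b) \<Rightarrow> bool"
  assumes "sentence \<phi>"
    and "\<And>v w. Z (qdepth \<phi>) {} v w"
    and "\<And>k V v w x y. Z k V v w \<Longrightarrow> x \<in> V \<Longrightarrow> y \<in> V \<Longrightarrow> v x = v y \<longleftrightarrow> w x = w y"
    and "\<And>k V v w x y r. Z k V v w \<Longrightarrow> x \<in> V \<Longrightarrow> y \<in> V \<Longrightarrow>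
      I r (v x) (v y) \<longleftrightarrow> J r (w x) (w y)"
    and "\<And>k V v w x a. Z (Suc k) V v w \<Longrightarrow> a \<in> A \<Longrightarrow>
      \<exists>b\<in>B. Z k (insert x V) (v(x := a)) (w(x := b))"
    and "\<And>k V v w x b. Z (Suc k) V v w \<Longrightarrow> b \<in> B \<Longrightarrow>
      \<exists>a\<in>A. Z k (insert x V) (v(x := a)) (w(x := b))"
  shows "models A I \<phi> \<longleftrightarrow> models B J \<phi>"
proof -
  fix v :: "nat \<Rightarrow> 'a" and w :: "nat \<Rightarrow> 'b"
  have "sat A I v \<phi> \<longleftrightarrow> sat B J w \<phi>"
    using assms(1)
    by (intro sat_back_and_forth[where Z = Z and k = "qdepth \<phi>" and V = "{}", OF assms(3-6)])
      (auto simp: sentence_def assms(2))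
  then show ?thesis
    by (simp add: models_iff_sat[OF assms(1), of A I v] models_iff_sat[OF assms(1), of B J w])
qed

text \<open>Answering along \<open>h\<close> succeeds for any number of rounds, so the relation
  \<open>Z\<close> chosen here ignores its round counter.\<close>

lemma models_isomorphic:
  assumes "sentence \<phi>" and h: "bij_betw h A B"
    and hom: "\<And>r a b. a \<in> A \<Longrightarrow> b \<in> A \<Longrightarrow> I r a b \<longleftrightarrow> J r (h a) (h b)"
  shows "models A I \<phi> \<longleftrightarrow> models B J \<phi>"
proof (rule models_back_and_forth[where Z = "\<lambda>_ V v w. \<forall>x\<in>V. v x \<in> A \<and> w x = h (v x)"])
  fix V v w x y assume "\<forall>x\<in>V. v x \<in> A \<and> w x = h (v x)" "x \<in> V" "y \<in> V"
  then show "v x = v y \<longleftrightarrow> w x = w y"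
    using bij_betw_imp_inj_on[OF h] by (simp add: inj_on_eq_iff)
next
  fix V v w x a assume "\<forall>x\<in>V. v x \<in> A \<and> w x = h (v x)" "a \<in> A"
  then show "\<exists>b\<in>B. \<forall>y\<in>insert x V. (v(x := a)) y \<in> A \<and> (w(x := b)) y = h ((v(x := a)) y)"
    using bij_betwE[OF h] by (intro bexI[of _ "h a"]) auto
next
  fix V v w x b assume *: "\<forall>x\<in>V. v x \<in> A \<and> w x = h (v x)" "b \<in> B"
  obtain a where "a \<in> A" "b = h a"
    using * h by (metis bij_betw_imp_surj_on imageE)
  with * show "\<exists>a\<in>A. \<forall>y\<in>insert x V. (v(x := a)) y \<in> A \<and> (w(x := b)) y = h ((v(x := a)) y)"
    by (intro bexI[of _ a]) auto
qed (use assms in auto)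

section \<open>Inflations by linear orders\<close>

text \<open>For \<open>t > 0\<close> this is equality after truncation to the interval from
  \<open>- t\<close> to \<open>t\<close>, the usual invariant of the game on linear orders.\<close>

definition near :: "int \<Rightarrow> int \<Rightarrow> int \<Rightarrow> bool" where
  "near t d e \<longleftrightarrow> d = e \<or> (t \<le> d \<and> t \<le> e) \<or> (d \<le> - t \<and> e \<le> - t)"

definition locally_isometric :: "int \<Rightarrow> (int \<times> int) set \<Rightarrow> bool" where
  "locally_isometric t S \<longleftrightarrow> (\<forall>(p, p')\<in>S. \<forall>(q, q')\<in>S. near t (p - q) (p' - q'))"

lemma locally_isometricD:
  "locally_isometric t S \<Longrightarrow> (p, p') \<in> S \<Longrightarrow> (q, q') \<in> S \<Longrightarrow> near t (p - q) (p' - q')"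
  unfolding locally_isometric_def by blast

lemma locally_isometric_subset:
  "locally_isometric t S \<Longrightarrow> S' \<subseteq> S \<Longrightarrow> locally_isometric t S'"
  unfolding locally_isometric_def by blast

lemma near_commute: "near t d e \<longleftrightarrow> near t e d"
  unfolding near_def by auto

lemma locally_isometric_converse:
  assumes "locally_isometric t S"
  shows "locally_isometric t (S\<inverse>)"
proof -
  have "near t (p - q) (p' - q')" if "(p', p) \<in> S" "(q', q) \<in> S" for p p' q q'
    using locally_isometricD[OF assms that] by (simp only: near_commute[of t "p - q"])
  then show ?thesis unfolding locally_isometric_def by auto
qed

lemma locally_isometric_mono:
  assumes "locally_isometric t S" "t' \<le> t"
  shows "locally_isometric t' S"
proof -
  have "near t' d e" if "near t d e" for d e
    using that assms(2) unfolding near_def by linarith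
  then show ?thesis
    using assms(1) unfolding locally_isometric_def by (simp add: case_prod_beta)
qed

lemma near_sgn: "near t d e \<Longrightarrow> t \<ge> 1 \<Longrightarrow> sgn d = sgn e"
  by (auto simp: near_def sgn_if)

text \<open>The new point copies its distance to a neighbour closer than \<open>t\<close>, if there is one;
  otherwise the gap has length at least \<open>2 * t\<close>, and so has its image.\<close>

lemma locally_isometric_extend:
  assumes iso: "locally_isometric (2 * t) S" and "finite S" and t: "t \<ge> 1"
    and l: "(l, l') \<in> S" "l \<le> a" and u: "(u, u') \<in> S" "a \<le> u"
  shows "\<exists>a'. locally_isometric t (insert (a, a') S)"
proof -
  let ?L = "{p \<in> fst ` S. p \<le> a}" and ?U = "{p \<in> fst ` S. a \<le> p}"
  have fin: "finite ?L" "finite ?U" using \<open>finite S\<close> by auto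
  have "l \<in> ?L" "u \<in> ?U" using l u by (auto intro: rev_image_eqI)
  then have ne: "?L \<noteq> {}" "?U \<noteq> {}" by blast+
  \<comment> \<open>The nearest old points on the two sides of \<open>a\<close>; they exist because
    of \<open>l\<close> and \<open>u\<close>.\<close>
  define x y where "x = Max ?L" and "y = Min ?U"
  have "x \<in> ?L" "y \<in> ?U"
    unfolding x_def y_def by (rule Max_in[OF fin(1) ne(1)], rule Min_in[OF fin(2) ne(2)])
  then obtain x' y' where x: "(x, x') \<in> S" "x \<le> a" and y: "(y, y') \<in> S" "a \<le> y" by auto
  have gap: "p \<le> x \<or> y \<le> p" if "(p, p') \<in> S" for p p'
  proof (cases "p \<le> a")
    case True
    then have "p \<in> ?L" using that by (auto intro: rev_image_eqI)
    then show ?thesis unfolding x_def using Max_ge[OF fin(1)] by simp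
  next
    case False
    then have "p \<in> ?U" using that by (auto intro: rev_image_eqI)
    then show ?thesis unfolding y_def using Min_le[OF fin(2)] by simp
  qed
  define a' where "a' = (if a - x < t then x' + (a - x)
    else if y - a < t then y' - (y - a) else x' + t)"
  have key: "near t (p - a) (p' - a')" if p: "(p, p') \<in> S" for p p'
  proof -
    have hx: "near (2 * t) (p - x) (p' - x')" and hy: "near (2 * t) (p - y) (p' - y')"
      and xy: "near (2 * t) (y - x) (y' - x')"
      using p x y by (auto intro: locally_isometricD[OF iso])
    consider "a - x < t" "a' = x' + (a - x)" | "a - x \<ge> t" "y - a < t" "a' = y' - (y - a)"
      | "a - x \<ge> t" "y - a \<ge> t" "a' = x' + t"
      unfolding a'_def by (meson not_less)
    then show ?thesis
    proof cases
      \<comment> \<open>In cases 1 and 2 the distances to \<open>a\<close> and \<open>a'\<close>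
        arise from those to a neighbour and its image by a common shift of less than
        \<open>t\<close>, so agreement up to \<open>2 * t\<close> leaves agreement up to
        \<open>t\<close>.\<close>
      case 1
      with hx gap[OF p] x(2) y(2) t show ?thesis unfolding near_def by linarith
    next
      case 2
      with hy gap[OF p] x(2) y(2) t show ?thesis unfolding near_def by linarith
    next
      case 3
      with hx hy xy gap[OF p] x(2) y(2) t show ?thesis unfolding near_def by linarith
    qed
  qed
  have "near t (a - p) (a' - p')" if "(p, p') \<in> S" for p p'
    using key[OF that] unfolding near_def by auto
  moreover have "near t (p - q) (p' - q')" if "(p, p') \<in> S" "(q, q') \<in> S" for p p' q q'
    using locally_isometricD[OF iso that] t unfolding near_def by auto
  moreover have "near t 0 0" by (simp add: near_def)
  ultimately have "locally_isometric t (insert (a, a') S)"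
    using key unfolding locally_isometric_def by auto
  then show ?thesis ..
qed

text \<open>The pairs \<open>(-1, -1)\<close> and \<open>(m c, m' c)\<close> are virtual points just outside the block \<open>c\<close>.\<close>

definition block_pairs ::
  "('c \<Rightarrow> int) \<Rightarrow> ('c \<Rightarrow> int) \<Rightarrow> nat set \<Rightarrow> (nat \<Rightarrow> 'c \<times> int) \<Rightarrow> (nat \<Rightarrow> 'c \<times> int) \<Rightarrow> 'c \<Rightarrow> (int \<times> int) set"
  where "block_pairs m m' V v w c =
    {(-1, -1), (m c, m' c)} \<union> (\<lambda>x. (snd (v x), snd (w x))) ` {x \<in> V. fst (v x) = c}"

text \<open>Only an inclusion, since a previous pair of \<open>x\<close> may disappear when
  \<open>x\<close> is already in \<open>V\<close>.\<close>

lemma block_pairs_upd: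
  "block_pairs m m' (insert x V) (v(x := (d, i))) (w(x := (d, j))) c \<subseteq>
    (if c = d then insert (i, j) (block_pairs m m' V v w c) else block_pairs m m' V v w c)"
  unfolding block_pairs_def by auto

text \<open>The game position with \<open>k\<close> rounds left. The threshold is
  \<open>2 ^ k\<close> because every use of \<open>locally_isometric_extend\<close> halves
  it.\<close>

definition block_equiv ::
  "'c set \<Rightarrow> ('c \<Rightarrow> int) \<Rightarrow> ('c \<Rightarrow> int) \<Rightarrow> nat \<Rightarrow> nat set \<Rightarrow> (nat \<Rightarrow> 'c \<times> int) \<Rightarrow> (nat \<Rightarrow> 'c \<times> int) \<Rightarrow> bool"
  where "block_equiv C m m' k V v w \<longleftrightarrow> finite V \<and>
    (\<forall>x\<in>V. fst (v x) = fst (w x) \<and> fst (v x) \<in> C) \<and>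
    (\<forall>c\<in>C. locally_isometric (2 ^ k) (block_pairs m m' V v w c))"

lemma block_equiv_sym:
  "block_equiv C m m' k V v w \<longleftrightarrow> block_equiv C m' m k V w v"
proof -
  have "block_equiv C m' m k V w v" if "block_equiv C m m' k V v w" for m m' v w
  proof -
    have "block_pairs m' m V w v c = (block_pairs m m' V v w c)\<inverse>" for c
      using that unfolding block_equiv_def block_pairs_def by (auto simp: image_iff)
    with that show ?thesis
      unfolding block_equiv_def by (auto intro: locally_isometric_converse)
  qed
  then show ?thesis by blast
qed

lemma block_equiv_forth:
  assumes Z: "block_equiv C m m' (Suc k) V v w" and a: "a \<in> (SIGMA c:C. {0..<m c})"
  shows "\<exists>b\<in>(SIGMA c:C. {0..<m' c}). block_equiv C m m' k (insert x V) (v(x := a)) (w(x := b))"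
proof -
  obtain d i where d: "a = (d, i)" "d \<in> C" "0 \<le> i" "i < m d" using a by auto
  let ?S = "block_pairs m m' V v w"
  have iso: "locally_isometric (2 * 2 ^ k) (?S c)" if "c \<in> C" for c
    using Z that unfolding block_equiv_def by simp
  have ends: "(-1, -1) \<in> ?S d" "(m d, m' d) \<in> ?S d" by (auto simp: block_pairs_def)
  have "finite (?S d)" using Z by (simp add: block_equiv_def block_pairs_def)
  then obtain j where j: "locally_isometric (2 ^ k) (insert (i, j) (?S d))"
    using locally_isometric_extend[OF iso[OF d(2)] _ _ ends(1) _ ends(2), of i] d(3,4) by auto
  have pos: "(1::int) \<le> 2 ^ k" by simp
  \<comment> \<open>Comparison with the two virtual points, at a threshold of at least 1, forces the
    answer \<open>j\<close> to lie inside the block.\<close>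
  have "near (2 ^ k) (i - (-1)) (j - (-1))" "near (2 ^ k) (m d - i) (m' d - j)"
    using ends by (auto simp del: diff_minus_eq_add intro!: locally_isometricD[OF j])
  then have "0 \<le> j" "j < m' d"
    using d(3,4) pos unfolding near_def by linarith+
  moreover have "locally_isometric (2 ^ k)
      (block_pairs m m' (insert x V) (v(x := a)) (w(x := (d, j))) c)" if "c \<in> C" for c
  proof (cases "c = d")
    case True
    show ?thesis
      by (rule locally_isometric_subset[OF j])
        (use block_pairs_upd[of m m' x V v d i w j d] in \<open>simp add: True d(1)\<close>)
  next
    case False
    have "locally_isometric (2 ^ k) (?S c)"
      using locally_isometric_mono[OF iso[OF that]] by simp
    then show ?thesis
      by (rule locally_isometric_subset)
        (use block_pairs_upd[of m m' x V v d i w j c] False in \<open>simp add: d(1)\<close>)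
  qed
  ultimately show ?thesis
    using Z d by (intro bexI[of _ "(d, j)"]) (auto simp: block_equiv_def)
qed

text \<open>The game splits into one game per block: \<open>I\<close> sees only the order of two
  positions within a block, and only the blocks themselves otherwise. Linear orders of length at
  least \<open>2 ^ k\<close> cannot be told apart in \<open>k\<close> rounds.\<close>

lemma models_inflation:
  fixes I :: "'r \<Rightarrow> 'c \<times> int \<Rightarrow> 'c \<times> int \<Rightarrow> bool"
  assumes "sentence \<phi>"
    and large: "\<And>c. c \<in> C \<Longrightarrow> m c = m' c \<or> (2 ^ qdepth \<phi> \<le> m c \<and> 2 ^ qdepth \<phi> \<le> m' c)"
    and I: "\<And>r c d i j i' j'. c \<in> C \<Longrightarrow> d \<in> C \<Longrightarrow>
      c = d \<Longrightarrow> sgn (i - j) = sgn (i' - j') \<Longrightarrow> I r (c, i) (d, j) \<longleftrightarrow> I r (c, i') (d, j')"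
    and I_neq: "\<And>r c d i j i' j'. c \<in> C \<Longrightarrow> d \<in> C \<Longrightarrow>
      c \<noteq> d \<Longrightarrow> I r (c, i) (d, j) \<longleftrightarrow> I r (c, i') (d, j')"
  shows "models (SIGMA c:C. {0..<m c}) I \<phi> \<longleftrightarrow> models (SIGMA c:C. {0..<m' c}) I \<phi>"
proof (rule models_back_and_forth[where Z = "block_equiv C m m'"])
  show "block_equiv C m m' (qdepth \<phi>) {} v w" for v w :: "nat \<Rightarrow> 'c \<times> int"
  proof -
    \<comment> \<open>At the start only the virtual points are placed, at distance
      \<open>m c + 1\<close> in one structure and \<open>m' c + 1\<close> in the other.\<close>
    have "near (2 ^ qdepth \<phi>) (m c + 1) (m' c + 1)" "near (2 ^ qdepth \<phi>) (- 1 - m c) (- 1 - m' c)"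
      if "c \<in> C" for c
      using large[OF that] unfolding near_def by linarith+
    then show ?thesis
      by (simp add: block_equiv_def block_pairs_def locally_isometric_def) (simp add: near_def)
  qed
next
  fix k V x y and v w :: "nat \<Rightarrow> 'c \<times> int"
  assume Z: "block_equiv C m m' k V v w" and x: "x \<in> V" and y: "y \<in> V"
  obtain c i i' where vx: "v x = (c, i)" "w x = (c, i')" "c \<in> C"
    using Z x unfolding block_equiv_def by (metis prod.collapse)
  obtain d j j' where vy: "v y = (d, j)" "w y = (d, j')" "d \<in> C"
    using Z y unfolding block_equiv_def by (metis prod.collapse)
  have sgn: "sgn (i - j) = sgn (i' - j')" if "c = d"
  proof (rule near_sgn)
    have "(i, i') \<in> block_pairs m m' V v w c" "(j, j') \<in> block_pairs m m' V v w c"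
      using x y vx vy that by (auto simp: block_pairs_def intro: rev_image_eqI)
    moreover have "locally_isometric (2 ^ k) (block_pairs m m' V v w c)"
      using Z vx by (simp add: block_equiv_def)
    ultimately show "near (2 ^ k) (i - j) (i' - j')"
      by (blast intro: locally_isometricD)
  qed simp
  have "i = j \<longleftrightarrow> i' = j'" if "c = d"
    using sgn[OF that] by (simp add: sgn_if split: if_splits)
  then show "v x = v y \<longleftrightarrow> w x = w y"
    by (auto simp: vx vy)
  show "I r (v x) (v y) \<longleftrightarrow> I r (w x) (w y)" for r
  proof (cases "c = d")
    case True
    show ?thesis unfolding vx vy by (rule I[OF vx(3) vy(3) True sgn[OF True]])
  next
    case False
    show ?thesis unfolding vx vy by (rule I_neq[OF vx(3) vy(3) False])
  qed
next
  fix k V v w x a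
  assume "block_equiv C m m' (Suc k) V v w" "a \<in> (SIGMA c:C. {0..<m c})"
  then show "\<exists>b\<in>(SIGMA c:C. {0..<m' c}). block_equiv C m m' k (insert x V) (v(x := a)) (w(x := b))"
    by (rule block_equiv_forth)
next
  fix k V v w x b
  assume "block_equiv C m m' (Suc k) V v w" "b \<in> (SIGMA c:C. {0..<m' c})"
  then show "\<exists>a\<in>(SIGMA c:C. {0..<m c}). block_equiv C m m' k (insert x V) (v(x := a)) (w(x := b))"
    using block_equiv_forth[of C m' m k V w v b x] block_equiv_sym by metis
qed fact

section \<open>Resizing monotone blocks\<close>

text \<open>A point of the permutation is represented by its first coordinate alone, in any linear
  order, so that direct sums and conjugates need no renumbering.\<close>

primrec perm_interp :: "('a::linorder \<Rightarrow> 'a) \<Rightarrow> toto_sym \<Rightarrow> 'a \<Rightarrow> 'a \<Rightarrow> bool" where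
  "perm_interp s LessP a b \<longleftrightarrow> a < b"
| "perm_interp s LessV a b \<longleftrightarrow> s a < s b"

text \<open>Direct sums: \<open>t\<close> permutes a set of negative numbers and \<open>r\<close> an initial segment of the
  nonnegative ones.\<close>

definition prolong :: "(int \<Rightarrow> int) \<Rightarrow> (int \<Rightarrow> int) \<Rightarrow> int \<Rightarrow> int" where
  "prolong t r x = (if x < 0 then t x else r x)"

definition rot :: "nat \<Rightarrow> nat \<Rightarrow> int \<Rightarrow> int" where
  "rot n b x = (x + int b) mod int n"

text \<open>Here the two increasing runs become visible: lengths \<open>a\<close> and
  \<open>b\<close>, the values of the second run below those of the first.\<close>

lemma rot_add:
  assumes "0 \<le> x" "x < int (a + b)" "b > 0"
  shows "rot (a + b) b x = (if x < int a then x + int b else x - int a)"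
proof (cases "x < int a")
  case False
  have "(x + int b) mod int (a + b) = (x - int a) mod int (a + b)"
    using mod_add_self2[of "x - int a" "int (a + b)"] by (simp add: algebra_simps)
  then show ?thesis using assms False by (simp add: rot_def)
qed (use assms in \<open>simp add: rot_def\<close>)

lemma bij_betw_rot:
  assumes "n > 0"
  shows "bij_betw (rot n b) {0..<int n} {0..<int n}"
proof -
  have "inj_on (rot n b) {0..<int n}"
  proof (rule inj_onI)
    fix x y assume *: "x \<in> {0..<int n}" "y \<in> {0..<int n}" "rot n b x = rot n b y"
    then have "x mod int n = y mod int n"
      unfolding rot_def mod_eq_dvd_iff by simp
    with * show "x = y" by simp
  qed
  moreover have "rot n b ` {0..<int n} \<subseteq> {0..<int n}"
    using assms by (auto simp: rot_def)
  ultimately show ?thesis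
    by (simp add: bij_betw_def endo_inj_surj)
qed

lemma bij_betw_prolong:
  assumes t: "bij_betw t T T" "T \<subseteq> {..<0}" and r: "bij_betw r {0..<int n} {0..<int n}"
  shows "bij_betw (prolong t r) (T \<union> {0..<int n}) (T \<union> {0..<int n})"
proof (rule bij_betw_combine)
  show "bij_betw (prolong t r) T T"
    using t by (subst bij_betw_cong[where g = t]) (auto simp: prolong_def)
  show "bij_betw (prolong t r) {0..<int n} {0..<int n}"
    using r by (subst bij_betw_cong[where g = r]) (auto simp: prolong_def)
  show "T \<inter> {0..<int n} = {}" using t(2) by auto
qed

definition flip :: "nat \<Rightarrow> int \<Rightarrow> int" where
  "flip m x = int m - 1 - x"

lemma bij_betw_flip: "bij_betw (flip m) {0..<int m} {0..<int m}"
  by (rule bij_betw_byWitness[where f' = "flip m"]) (auto simp: flip_def)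

text \<open>The permutation is an inflation: each point of \<open>T\<close> is a block of length 1,
  and the rotation supplies two increasing blocks, indexed 0 and 1. Only these two change their
  lengths.\<close>

lemma models_rot:
  assumes \<phi>: "sentence \<phi>" and T: "T \<subseteq> {..<0}" and t: "bij_betw t T T"
    and a: "a = a' \<or> (2 ^ qdepth \<phi> \<le> a \<and> 2 ^ qdepth \<phi> \<le> a')"
    and b: "b = b' \<or> (2 ^ qdepth \<phi> \<le> b \<and> 2 ^ qdepth \<phi> \<le> b')" and pos: "b > 0" "b' > 0"
  shows "models (T \<union> {0..<int (a + b)}) (perm_interp (prolong t (rot (a + b) b))) \<phi> \<longleftrightarrow>
    models (T \<union> {0..<int (a' + b')}) (perm_interp (prolong t (rot (a' + b') b'))) \<phi>"
proof -
  define C :: "int set" where "C = T \<union> {0, 1}"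
  define m :: "nat \<Rightarrow> nat \<Rightarrow> int \<Rightarrow> int" where
    "m a b c = (if c < 0 then 1 else if c = 0 then int a else int b)" for a b c
  \<comment> \<open>The permutation induced on the block indices: \<open>t\<close> on
    \<open>T\<close>, while the two runs of the rotation are exchanged.\<close>
  define u :: "int \<Rightarrow> int" where "u c = (if c < 0 then t c else 1 - c)" for c
  define I where "I r p q = (case r of
      LessP \<Rightarrow> fst p < fst q \<or> (fst p = fst q \<and> snd p < snd q)
    | LessV \<Rightarrow> u (fst p) < u (fst q) \<or> (fst p = fst q \<and> snd p < snd q))"
    for r and p q :: "int \<times> int"
  have tT: "t c < 0" if "c \<in> T" for c using bij_betwE[OF t] T that by auto
  have t_eq: "t c = t d \<longleftrightarrow> c = d" if "c \<in> T" "d \<in> T" for c d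
    using t that by (auto simp: bij_betw_def inj_on_eq_iff)
  have iso: "models (SIGMA c:C. {0..<m a b c}) I \<phi> \<longleftrightarrow>
    models (T \<union> {0..<int (a + b)}) (perm_interp (prolong t (rot (a + b) b))) \<phi>"
    if "b > 0" for a b
  proof (rule models_isomorphic[OF \<phi>])
    define h :: "int \<times> int \<Rightarrow> int" where
      "h p = (if fst p < 0 then fst p else if fst p = 0 then snd p else int a + snd p)" for p
    show "bij_betw h (SIGMA c:C. {0..<m a b c}) (T \<union> {0..<int (a + b)})"
      by (rule bij_betw_byWitness[where f' =
            "\<lambda>x. if x < 0 then (x, 0) else if x < int a then (0, x) else (1, x - int a)"])
        (use T in \<open>auto simp: h_def C_def m_def split: if_splits\<close>)
    show "I r p q \<longleftrightarrow> perm_interp (prolong t (rot (a + b) b)) r (h p) (h q)"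
      if p: "p \<in> (SIGMA c:C. {0..<m a b c})" and q: "q \<in> (SIGMA c:C. {0..<m a b c})" for r p q
    proof -
      have pr: "prolong t (rot (a + b) b) (h p) =
          (if fst p < 0 then t (fst p) else if fst p = 0 then snd p + int b else snd p)"
        if "p \<in> (SIGMA c:C. {0..<m a b c})" for p
        using that T \<open>b > 0\<close> rot_add[of "h p" a b]
        by (auto simp: h_def prolong_def C_def m_def split: if_splits)
      show ?thesis
      proof (cases r)
        case LessP
        then show ?thesis using p q T by (auto simp: I_def h_def C_def m_def split: if_splits)
      next
        case LessV
        have "fst p \<in> C" "0 \<le> snd p" "snd p < m a b (fst p)"
          "fst q \<in> C" "0 \<le> snd q" "snd q < m a b (fst q)" using p q by auto
        moreover have "t (fst p) < 0" if "fst p \<in> T" using tT that by simp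
        moreover have "t (fst q) < 0" if "fst q \<in> T" using tT that by simp
        ultimately show ?thesis using T
          unfolding LessV I_def u_def C_def m_def perm_interp.simps(2) toto_sym.case pr[OF p] pr[OF q]
          by (auto split: if_splits)
      qed
    qed
  qed
  have "models (SIGMA c:C. {0..<m a b c}) I \<phi> \<longleftrightarrow> models (SIGMA c:C. {0..<m a' b' c}) I \<phi>"
  proof (rule models_inflation[OF \<phi>])
    show "m a b c = m a' b' c \<or> 2 ^ qdepth \<phi> \<le> m a b c \<and> 2 ^ qdepth \<phi> \<le> m a' b' c" for c
    proof -
      have "int (2 ^ qdepth \<phi>) \<le> int n \<longleftrightarrow> 2 ^ qdepth \<phi> \<le> n" for n
        by (rule of_nat_le_iff)
      then show ?thesis using a b by (auto simp: m_def)
    qed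
    show "I r (c, i) (d, j) \<longleftrightarrow> I r (c, i') (d, j')"
      if "c = d" "sgn (i - j) = sgn (i' - j')" for r c d i j i' j'
      using that by (cases r) (auto simp: I_def sgn_if split: if_splits)
    show "I r (c, i) (d, j) \<longleftrightarrow> I r (c, i') (d, j')" if "c \<noteq> d" for r c d i j i' j'
      using that by (cases r) (auto simp: I_def)
  qed
  then show ?thesis using iso pos by simp
qed

text \<open>Same argument as for \<open>models_rot\<close>, with the reversal as one decreasing
  block of index 0.\<close>

lemma models_flip:
  assumes \<phi>: "sentence \<phi>" and T: "T \<subseteq> {..<0}" and t: "bij_betw t T T"
    and m: "2 ^ qdepth \<phi> \<le> m" "2 ^ qdepth \<phi> \<le> m'"
  shows "models (T \<union> {0..<int m}) (perm_interp (prolong t (flip m))) \<phi> \<longleftrightarrow>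
    models (T \<union> {0..<int m'}) (perm_interp (prolong t (flip m'))) \<phi>"
proof -
  define C :: "int set" where "C = T \<union> {0}"
  define l :: "nat \<Rightarrow> int \<Rightarrow> int" where "l m c = (if c < 0 then 1 else int m)" for m c
  define u :: "int \<Rightarrow> int" where "u c = (if c < 0 then t c else c)" for c
  \<comment> \<open>The comparison \<open>snd p > snd q\<close> makes blocks decreasing; on the
    blocks of length 1 over \<open>T\<close> it has no effect.\<close>
  define I where "I r p q = (case r of
      LessP \<Rightarrow> fst p < fst q \<or> (fst p = fst q \<and> snd p < snd q)
    | LessV \<Rightarrow> u (fst p) < u (fst q) \<or> (fst p = fst q \<and> snd p > snd q))"
    for r and p q :: "int \<times> int"
  have tT: "t c < 0" if "c \<in> T" for c using bij_betwE[OF t] T that by auto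
  have iso: "models (SIGMA c:C. {0..<l m c}) I \<phi> \<longleftrightarrow>
    models (T \<union> {0..<int m}) (perm_interp (prolong t (flip m))) \<phi>" for m
  proof (rule models_isomorphic[OF \<phi>])
    define h :: "int \<times> int \<Rightarrow> int" where "h p = (if fst p < 0 then fst p else snd p)" for p
    show "bij_betw h (SIGMA c:C. {0..<l m c}) (T \<union> {0..<int m})"
      by (rule bij_betw_byWitness[where f' = "\<lambda>x. if x < 0 then (x, 0) else (0, x)"])
        (use T in \<open>auto simp: h_def C_def l_def split: if_splits\<close>)
    show "I r p q \<longleftrightarrow> perm_interp (prolong t (flip m)) r (h p) (h q)"
      if p: "p \<in> (SIGMA c:C. {0..<l m c})" and q: "q \<in> (SIGMA c:C. {0..<l m c})" for r p q
    proof -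
      have pr: "prolong t (flip m) (h p) = (if fst p < 0 then t (fst p) else int m - 1 - snd p)"
        if "p \<in> (SIGMA c:C. {0..<l m c})" for p
        using that T by (auto simp: h_def prolong_def flip_def C_def l_def split: if_splits)
      show ?thesis
      proof (cases r)
        case LessP
        then show ?thesis using p q T by (auto simp: I_def h_def C_def l_def split: if_splits)
      next
        case LessV
        have "fst p \<in> C" "0 \<le> snd p" "snd p < l m (fst p)"
          "fst q \<in> C" "0 \<le> snd q" "snd q < l m (fst q)" using p q by auto
        moreover have "t (fst p) < 0" if "fst p \<in> T" using tT that by simp
        moreover have "t (fst q) < 0" if "fst q \<in> T" using tT that by simp
        ultimately show ?thesis using T
          unfolding LessV I_def u_def C_def l_def perm_interp.simps(2) toto_sym.case pr[OF p] pr[OF q]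
          by (auto split: if_splits)
      qed
    qed
  qed
  have "models (SIGMA c:C. {0..<l m c}) I \<phi> \<longleftrightarrow> models (SIGMA c:C. {0..<l m' c}) I \<phi>"
  proof (rule models_inflation[OF \<phi>])
    show "l m c = l m' c \<or> 2 ^ qdepth \<phi> \<le> l m c \<and> 2 ^ qdepth \<phi> \<le> l m' c" for c
    proof -
      have "int (2 ^ qdepth \<phi>) \<le> int n \<longleftrightarrow> 2 ^ qdepth \<phi> \<le> n" for n
        by (rule of_nat_le_iff)
      then show ?thesis using m by (auto simp: l_def)
    qed
    show "I r (c, i) (d, j) \<longleftrightarrow> I r (c, i') (d, j')"
      if "c = d" "sgn (i - j) = sgn (i' - j')" for r c d i j i' j'
      using that by (cases r) (auto simp: I_def sgn_if split: if_splits)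
    show "I r (c, i) (d, j) \<longleftrightarrow> I r (c, i') (d, j')" if "c \<noteq> d" for r c d i j i' j'
      using that by (cases r) (auto simp: I_def)
  qed
  then show ?thesis using iso by simp
qed

section \<open>Cycles of finite permutations\<close>

definition period :: "('a \<Rightarrow> 'a) \<Rightarrow> 'a \<Rightarrow> nat" where
  "period s x = (LEAST n. 0 < n \<and> (s ^^ n) x = x)"

lemma funpow_mem: "bij_betw s D D \<Longrightarrow> x \<in> D \<Longrightarrow> (s ^^ n) x \<in> D"
  by (rule bij_betwE[OF bij_betw_funpow, rule_format])

lemma funpow_cancel:
  assumes s: "bij_betw s D D" and x: "x \<in> D" and eq: "(s ^^ i) x = (s ^^ j) x" and "i \<le> j"
  shows "(s ^^ (j - i)) x = x"
proof -
  have "(s ^^ i) ((s ^^ (j - i)) x) = (s ^^ i) x"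
    using eq \<open>i \<le> j\<close> by (metis comp_apply funpow_add le_add_diff_inverse)
  moreover have "inj_on (s ^^ i) D"
    using bij_betw_funpow[OF s] by (rule bij_betw_imp_inj_on)
  ultimately show ?thesis
    using x funpow_mem[OF s x] by (auto dest: inj_onD)
qed

lemma ex_period:
  assumes s: "bij_betw s D D" and D: "finite D" and x: "x \<in> D"
  shows "\<exists>n>0. (s ^^ n) x = x"
proof -
  have "\<not> inj (\<lambda>i. (s ^^ i) x)"
    using funpow_mem[OF s x] D by (meson finite_subset image_subsetI infinite_UNIV_nat finite_imageD)
  then obtain i j where "(s ^^ i) x = (s ^^ j) x" "i \<noteq> j"
    unfolding inj_def by blast
  then have "\<exists>i j. (s ^^ i) x = (s ^^ j) x \<and> i < j"
    by (metis linorder_neqE_nat)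
  then obtain i j where "(s ^^ i) x = (s ^^ j) x" "i < j" by blast
  then show ?thesis
    using funpow_cancel[OF s x] by (intro exI[of _ "j - i"]) auto
qed

lemma
  assumes s: "bij_betw s D D" and D: "finite D" and x: "x \<in> D"
  shows period_pos: "period s x > 0"
    and funpow_period: "(s ^^ period s x) x = x"
    and inj_on_funpow_period: "inj_on (\<lambda>i. (s ^^ i) x) {..<period s x}"
proof -
  have *: "0 < period s x \<and> (s ^^ period s x) x = x"
    unfolding period_def by (rule LeastI_ex[OF ex_period[OF assms]])
  then show "period s x > 0" "(s ^^ period s x) x = x" by auto
  have "\<not> ((s ^^ i) x = (s ^^ j) x)" if "i < j" "j < period s x" for i j
  proof
    assume "(s ^^ i) x = (s ^^ j) x"
    then have "(s ^^ (j - i)) x = x" using funpow_cancel[OF s x] that(1) by simp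
    then have "period s x \<le> j - i"
      unfolding period_def using that(1) by (intro Least_le) auto
    with that show False by simp
  qed
  then show "inj_on (\<lambda>i. (s ^^ i) x) {..<period s x}"
    by (intro inj_onI) (metis lessThan_iff linorder_neqE_nat)
qed

lemma period_eq_1_iff:
  assumes "bij_betw s D D" "finite D" "x \<in> D"
  shows "period s x = 1 \<longleftrightarrow> s x = x"
proof
  show "s x = x" if "period s x = 1"
    using funpow_period[OF assms] that by simp
  show "period s x = 1" if "s x = x"
  proof -
    have "period s x \<le> 1" unfolding period_def using that by (intro Least_le) auto
    with period_pos[OF assms] show ?thesis by simp
  qed
qed

text \<open>Greedy choice: \<open>M\<close> cycles of length \<open>l\<close> cover at most
  \<open>l * M\<close> points, so a further point of period \<open>l\<close> is left over.
  Injectivity on the index grid expresses that the chosen cycles are disjoint and have full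
  length.\<close>

lemma ex_cycle_representatives:
  assumes s: "bij_betw s D D" and D: "finite D" and l: "l > 0"
  shows "l * M \<le> card {x \<in> D. period s x = l} \<Longrightarrow>
    \<exists>x. (\<forall>j<M. x j \<in> D \<and> period s (x j) = l) \<and>
      inj_on (\<lambda>(i, j). (s ^^ i) (x j)) ({..<l} \<times> {..<M})"
proof (induction M)
  case (Suc M)
  let ?S = "{x \<in> D. period s x = l}"
  obtain x where x: "\<And>j. j < M \<Longrightarrow> x j \<in> D \<and> period s (x j) = l"
    and inj: "inj_on (\<lambda>(i, j). (s ^^ i) (x j)) ({..<l} \<times> {..<M})"
    using Suc by auto
  let ?W = "(\<lambda>(i, j). (s ^^ i) (x j)) ` ({..<l} \<times> {..<M})"
  have "card ?W \<le> l * M"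
    by (rule order.trans[OF card_image_le]) auto
  then have "\<not> ?S \<subseteq> ?W"
    using Suc.prems l card_mono[of ?W ?S] by fastforce
  then obtain y where y: "y \<in> D" "period s y = l" "y \<notin> ?W" by blast
  \<comment> \<open>If the cycle of \<open>y\<close> met an earlier one, following it for
    \<open>l - i\<close> further steps would come back to \<open>y\<close> and put \<open>y\<close>
    into \<open>?W\<close>.\<close>
  have new: "(s ^^ i) y \<noteq> (s ^^ i') (x j)" if "i < l" "j < M" for i i' j
  proof
    assume eq: "(s ^^ i) y = (s ^^ i') (x j)"
    have "y = (s ^^ (l - i)) ((s ^^ i) y)"
      using that(1) funpow_period[OF s D y(1)] y(2) by (simp flip: funpow_add[THEN fun_cong, unfolded comp_apply])
    also have "\<dots> = (s ^^ (l - i + i')) (x j)"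
      unfolding eq by (simp add: funpow_add)
    also have "\<dots> = (s ^^ ((l - i + i') mod l)) (x j)"
      using x[OF that(2)] funpow_period[OF s D, of "x j"] by (intro funpow_mod_eq[symmetric]) auto
    finally show False using y(3) that(2) l by force
  qed
  define z where "z = x(M := y)"
  have "inj_on (\<lambda>(i, j). (s ^^ i) (z j)) ({..<l} \<times> {..<Suc M})"
  proof (rule inj_onI; clarify)
    fix i j i' j' assume "i < l" "i' < l" "j < Suc M" "j' < Suc M"
      and eq: "(s ^^ i) (z j) = (s ^^ i') (z j')"
    then consider "j < M" "j' < M" | "j = M" "j' < M" | "j < M" "j' = M" | "j = M" "j' = M"
      by linarith
    then show "i = i' \<and> j = j'"
    proof cases
      case 1
      then show ?thesis using inj_onD[OF inj, of "(i, j)" "(i', j')"] eq \<open>i < l\<close> \<open>i' < l\<close>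
        by (simp add: z_def)
    next
      case 2
      then show ?thesis using new[OF \<open>i < l\<close>, of j' i'] eq by (simp add: z_def)
    next
      case 3
      then show ?thesis using new[OF \<open>i' < l\<close>, of j i] eq by (simp add: z_def)
    next
      case 4
      then show ?thesis
        using inj_onD[OF inj_on_funpow_period[OF s D y(1)], of i i'] eq \<open>i < l\<close> \<open>i' < l\<close> y(2)
        by (simp add: z_def)
    qed
  qed
  moreover have "\<forall>j<Suc M. z j \<in> D \<and> period s (z j) = l"
    using x y by (simp add: z_def less_Suc_eq)
  ultimately show ?case by blast
qed auto

section \<open>Conjugation-invariant sets\<close>

text \<open>Projection to the first coordinate followed by the increasing map \<open>f\<close>
  preserves both orders, so the structure on pairs may be replaced by \<open>D\<close> with
  \<open>s\<close>.\<close>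

lemma toto_models_transfer:
  fixes f :: "nat \<Rightarrow> 'a::linorder"
  assumes \<phi>: "sentence \<phi>" and \<tau>: "(n, \<tau>) \<in> perms"
    and f: "bij_betw f {1..n} D" "strict_mono_on {1..n} f"
    and s: "\<And>i. i \<in> {1..n} \<Longrightarrow> f (\<tau> i) = s (f i)"
  shows "(n, \<tau>) \<in> toto_models \<phi> \<longleftrightarrow> models D (perm_interp s) \<phi>"
proof -
  have "models (toto_dom (n, \<tau>)) toto_interp \<phi> \<longleftrightarrow> models D (perm_interp s) \<phi>"
  proof (rule models_isomorphic[OF \<phi>])
    have "bij_betw fst (toto_dom (n, \<tau>)) {1..n}"
      by (rule bij_betw_byWitness[where f' = "\<lambda>i. (i, \<tau> i)"]) (auto simp: toto_dom_def)
    then show "bij_betw (f \<circ> fst) (toto_dom (n, \<tau>)) D"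
      using f(1) by (rule bij_betw_trans)
  next
    fix r p q assume "p \<in> toto_dom (n, \<tau>)" "q \<in> toto_dom (n, \<tau>)"
    then obtain i j where p: "p = (i, \<tau> i)" "i \<in> {1..n}" and q: "q = (j, \<tau> j)" "j \<in> {1..n}"
      by (auto simp: toto_dom_def)
    have mono: "f i < f j \<longleftrightarrow> i < j" if "i \<in> {1..n}" "j \<in> {1..n}" for i j
      using f(2) that by (rule strict_mono_on_less)
    have "\<tau> i \<in> {1..n}" "\<tau> j \<in> {1..n}"
      using \<tau> p(2) q(2) by (auto simp: perms_def permutes_in_image simp del: atLeastAtMost_iff)
    then show "toto_interp r p q \<longleftrightarrow> perm_interp s r ((f \<circ> fst) p) ((f \<circ> fst) q)"
      using mono p q by (cases r) (simp_all flip: s del: atLeastAtMost_iff)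
  qed
  then show ?thesis using \<tau> by (simp add: toto_models_def)
qed

lemma ex_standardization:
  fixes D :: "'a::linorder set"
  assumes D: "finite D" and s: "bij_betw s D D"
  obtains \<tau> f where "(card D, \<tau>) \<in> perms" "bij_betw f {1..card D} D"
    "strict_mono_on {1..card D} f" "\<And>i. i \<in> {1..card D} \<Longrightarrow> f (\<tau> i) = s (f i)"
proof -
  let ?N = "{1..card D}"
  define h where "h i = sorted_list_of_set D ! i" for i
  have h: "bij_betw h {0..<card D} D"
    unfolding h_def using D by (intro bij_betw_nth) auto
  have h_mono: "h i < h j" if "i < j" "j < card D" for i j
    unfolding h_def using that by (intro sorted_wrt_nth_less[of "(<)"]) auto
  \<comment> \<open>List positions start at 0, the points of a sized permutation at 1.\<close>
  have pred: "bij_betw (\<lambda>i. i - 1) ?N {0..<card D}"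
    by (rule bij_betw_byWitness[where f' = Suc]) auto
  define f where "f = h \<circ> (\<lambda>i. i - 1)"
  have f: "bij_betw f ?N D" unfolding f_def using pred h by (rule bij_betw_trans)
  have mono: "strict_mono_on ?N f"
    by (rule strict_mono_onI) (auto simp: f_def intro!: h_mono)
  define \<tau> where "\<tau> i = (if i \<in> ?N then inv_into ?N f (s (f i)) else i)" for i
  have "bij_betw (inv_into ?N f \<circ> (s \<circ> f)) ?N ?N"
    by (rule bij_betw_trans[OF bij_betw_trans[OF f s] bij_betw_inv_into[OF f]])
  then have "bij_betw \<tau> ?N ?N"
    by (subst bij_betw_cong[where g = "inv_into ?N f \<circ> (s \<circ> f)"]) (auto simp: \<tau>_def)
  then have "\<tau> permutes ?N"
    by (rule bij_imp_permutes) (simp add: \<tau>_def del: atLeastAtMost_iff)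
  then have "(card D, \<tau>) \<in> perms" by (simp add: perms_def)
  moreover have "f (\<tau> i) = s (f i)" if "i \<in> ?N" for i
    using that bij_betwE[OF f] bij_betwE[OF s] bij_betw_inv_into_right[OF f]
    by (simp add: \<tau>_def del: atLeastAtMost_iff)
  ultimately show ?thesis using that f mono by blast
qed

locale conj_invariant_toto =
  fixes \<phi> :: "toto_sym fo"
  assumes \<phi>: "sentence \<phi>"
    and conj_invariant: "\<And>n \<sigma> \<tau> f. (n, \<sigma>) \<in> perms \<Longrightarrow> (n, \<tau>) \<in> perms \<Longrightarrow>
      bij_betw f {1..n} {1..n} \<Longrightarrow> (\<And>i. i \<in> {1..n} \<Longrightarrow> f (\<sigma> i) = \<tau> (f i)) \<Longrightarrow>
      (n, \<sigma>) \<in> toto_models \<phi> \<longleftrightarrow> (n, \<tau>) \<in> toto_models \<phi>"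
begin

definition holds :: "int set \<Rightarrow> (int \<Rightarrow> int) \<Rightarrow> bool" where
  "holds D s \<longleftrightarrow> models D (perm_interp s) \<phi>"

text \<open>The map \<open>f\<close> need not be monotone: the standardizations of \<open>s\<close>
  and \<open>s'\<close> have the same size and are conjugate by the map that \<open>f\<close>
  induces, so \<open>conj_invariant\<close> applies to them.\<close>

lemma holds_conj:
  assumes D: "finite D" "bij_betw s D D" and D': "bij_betw s' D' D'"
    and f: "bij_betw f D D'" "\<And>x. x \<in> D \<Longrightarrow> f (s x) = s' (f x)"
  shows "holds D s \<longleftrightarrow> holds D' s'"
proof -
  have card: "card D' = card D" using bij_betw_same_card[OF f(1)] by simp
  have fin': "finite D'" using bij_betw_finite[OF f(1)] D(1) by simp
  let ?N = "{1..card D}"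
  obtain \<sigma> g where g: "(card D, \<sigma>) \<in> perms" "bij_betw g ?N D" "strict_mono_on ?N g"
    and g_hom: "\<And>i. i \<in> ?N \<Longrightarrow> g (\<sigma> i) = s (g i)"
    using ex_standardization[OF D] by blast
  obtain \<tau> g' where g': "(card D, \<tau>) \<in> perms" "bij_betw g' ?N D'" "strict_mono_on ?N g'"
    and g'_hom: "\<And>i. i \<in> ?N \<Longrightarrow> g' (\<tau> i) = s' (g' i)"
    using ex_standardization[OF fin' D'] unfolding card by blast
  define h where "h = inv_into ?N g' \<circ> (f \<circ> g)"
  have h: "bij_betw h ?N ?N"
    unfolding h_def
    by (rule bij_betw_trans[OF bij_betw_trans[OF g(2) f(1)] bij_betw_inv_into[OF g'(2)]])
  have g'h: "g' (h i) = f (g i)" if "i \<in> ?N" for i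
    unfolding h_def using that bij_betwE[OF g(2)] bij_betwE[OF f(1)]
    by (simp add: bij_betw_inv_into_right[OF g'(2)] del: One_nat_def)
  have "h (\<sigma> i) = \<tau> (h i)" if i: "i \<in> ?N" for i
  proof -
    have \<sigma>i: "\<sigma> i \<in> ?N" using g(1) i by (simp add: perms_def permutes_in_image del: atLeastAtMost_iff)
    have hi: "h i \<in> ?N" using bij_betwE[OF h] i by blast
    then have \<tau>hi: "\<tau> (h i) \<in> ?N"
      using g'(1) by (simp add: perms_def permutes_in_image del: atLeastAtMost_iff)
    have "g i \<in> D" using bij_betwE[OF g(2)] i by blast
    then have "g' (h (\<sigma> i)) = g' (\<tau> (h i))"
      using g'h[OF \<sigma>i] g'_hom[OF hi] g'h[OF i] g_hom[OF i] f(2) by simp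
    then show ?thesis
      using bij_betw_imp_inj_on[OF g'(2)] bij_betwE[OF h] \<sigma>i \<tau>hi by (meson inj_onD)
  qed
  then have "(card D, \<sigma>) \<in> toto_models \<phi> \<longleftrightarrow> (card D, \<tau>) \<in> toto_models \<phi>"
    by (rule conj_invariant[OF g(1) g'(1) h])
  then show ?thesis
    using toto_models_transfer[OF \<phi> g(1,2,3) g_hom] toto_models_transfer[OF \<phi> g'(1,2,3) g'_hom]
    by (simp add: holds_def)
qed

text \<open>Numbering the \<open>i\<close>-th iterate of the \<open>j\<close>-th representative by
  \<open>i * M + j\<close> turns \<open>s\<close> into addition of \<open>M\<close> modulo
  \<open>l * M\<close>. The remaining points are moved to negative numbers in any order; the
  equation for \<open>card T\<close> serves later to see the rest shrink.\<close>

lemma holds_cycles_iff_rot: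
  assumes D: "finite D" "bij_betw s D D" and M: "M > 0" "l > 0"
    and x: "\<And>j. j < M \<Longrightarrow> x j \<in> D" "\<And>j. j < M \<Longrightarrow> (s ^^ l) (x j) = x j"
    and inj: "inj_on (\<lambda>(i, j). (s ^^ i) (x j)) ({..<l} \<times> {..<M})"
  shows "\<exists>T t. T \<subseteq> {..<0} \<and> finite T \<and> bij_betw t T T \<and> card T + l * M = card D \<and>
    (holds D s \<longleftrightarrow> holds (T \<union> {0..<int (l * M)}) (prolong t (rot (l * M) M)))"
proof -
  define P :: "(nat \<times> nat) set" where "P = {..<l} \<times> {..<M}"
  define g where "g = (\<lambda>(i, j). (s ^^ i) (x j))"
  define e :: "nat \<times> nat \<Rightarrow> int" where "e = (\<lambda>(i, j). int (i * M + j))"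
  \<comment> \<open>The action of \<open>s\<close> on the coordinates \<open>(i, j)\<close>: one
    step along the cycle, wrapping around at \<open>l\<close>.\<close>
  define nxt where "nxt = (\<lambda>(i, j::nat). (if Suc i = l then 0 else Suc i, j))"
  define W where "W = g ` P"
  have g: "bij_betw g P W"
    using inj by (simp add: bij_betw_def W_def P_def g_def)
  have bound: "i * M + j < l * M" if "i < l" "j < M" for i j
  proof -
    have "i * M + j < Suc i * M" using that by simp
    also have "\<dots> \<le> l * M" using that by (intro mult_le_mono1) simp
    finally show ?thesis .
  qed
  have e: "bij_betw e P {0..<int (l * M)}"
  proof (rule bij_betw_byWitness[where f' = "\<lambda>y. (nat y div M, nat y mod M)"])
    show "\<forall>p\<in>P. (nat (e p) div M, nat (e p) mod M) = p"
      by (auto simp: P_def e_def simp del: of_nat_add of_nat_mult)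
    show "\<forall>y\<in>{0..<int (l * M)}. e (nat y div M, nat y mod M) = y"
      by (auto simp: e_def simp del: of_nat_add of_nat_mult)
    show "e ` P \<subseteq> {0..<int (l * M)}"
      using bound by (auto simp: P_def e_def simp del: of_nat_add of_nat_mult)
    show "(\<lambda>y. (nat y div M, nat y mod M)) ` {0..<int (l * M)} \<subseteq> P"
      using M by (auto simp: P_def nat_less_iff intro!: less_mult_imp_div_less)
  qed
  have nxt_P: "nxt p \<in> P" if "p \<in> P" for p
    using that M by (auto simp: P_def nxt_def)
  have g_nxt: "g (nxt p) = s (g p)" if p: "p \<in> P" for p
  proof -
    obtain i j where ij: "p = (i, j)" "j < M" using p by (auto simp: P_def)
    have "s (g p) = (s ^^ Suc i) (x j)" by (simp add: g_def ij(1))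
    also have "\<dots> = g (nxt p)"
    proof (cases "Suc i = l")
      case True
      then show ?thesis using x(2)[OF ij(2)] by (simp add: g_def nxt_def ij(1) del: funpow.simps(2))
    qed (simp add: g_def nxt_def ij(1))
    finally show ?thesis ..
  qed
  have e_nxt: "e (nxt p) = rot (l * M) M (e p)" if p: "p \<in> P" for p
  proof -
    obtain i j where ij: "p = (i, j)" "i < l" "j < M" using p by (auto simp: P_def)
    have "rot (l * M) M (e p) = int ((Suc i * M + j) mod (l * M))"
      by (simp add: rot_def e_def ij(1) zmod_int add_ac)
    also have "(Suc i * M + j) mod (l * M) = (if Suc i = l then j else Suc i * M + j)"
    proof (cases "Suc i = l")
      case True
      have "j < l * M" using bound[of 0 j] ij M by simp
      then show ?thesis using True by simp
    next
      case False
      then have "Suc i * M + j < l * M" using ij by (intro bound) auto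
      then show ?thesis using False by simp
    qed
    also have "int \<dots> = e (nxt p)" by (simp add: ij(1) e_def nxt_def algebra_simps)
    finally show ?thesis ..
  qed
  have WD: "W \<subseteq> D"
    unfolding W_def P_def g_def using x(1) by (auto intro!: funpow_mem[OF D(2)])
  then have finW: "finite W" using D(1) finite_subset by blast
  have sW: "bij_betw s W W"
  proof -
    have "s ` W \<subseteq> W"
    proof
      fix y assume "y \<in> s ` W"
      then obtain p where p: "p \<in> P" "y = s (g p)" by (auto simp: W_def)
      then have "y = g (nxt p)" by (simp only: g_nxt)
      with nxt_P[OF p(1)] show "y \<in> W" unfolding W_def by blast
    qed
    moreover have "inj_on s W"
      using D(2) WD bij_betw_imp_inj_on inj_on_subset by blast
    ultimately show ?thesis
      using finW by (simp add: bij_betw_def endo_inj_surj)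
  qed
  have sDW: "bij_betw s (D - W) (D - W)"
    by (rule bij_betw_DiffI[OF D(2) sW WD WD])
  define T :: "int set" where "T = {- int (card (D - W))..<0}"
  have T: "T \<subseteq> {..<0}" "finite T" "card T = card (D - W)" by (auto simp: T_def)
  obtain h where h: "bij_betw h (D - W) T"
    using finite_same_card_bij[of "D - W" T] D(1) T by auto
  define t where "t = h \<circ> (s \<circ> inv_into (D - W) h)"
  have t: "bij_betw t T T"
    unfolding t_def by (rule bij_betw_trans[OF bij_betw_trans[OF bij_betw_inv_into[OF h] sDW] h])
  have "card W = l * M" using bij_betw_same_card[OF g] by (simp add: P_def)
  then have card: "card T + l * M = card D"
    using T(3) WD finW card_mono[OF D(1) WD] by (simp add: card_Diff_subset)
  define f where "f y = (if y \<in> W then e (inv_into P g y) else h y)" for y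
  have fg: "f (g p) = e p" if "p \<in> P" for p
    using that by (simp add: f_def W_def bij_betw_inv_into_left[OF g])
  have "bij_betw f ((D - W) \<union> W) (T \<union> {0..<int (l * M)})"
  proof (rule bij_betw_combine)
    show "bij_betw f (D - W) T"
      using h by (subst bij_betw_cong[where g = h]) (auto simp: f_def)
    have "bij_betw (e \<circ> inv_into P g) W {0..<int (l * M)}"
      by (rule bij_betw_trans[OF bij_betw_inv_into[OF g] e])
    then show "bij_betw f W {0..<int (l * M)}"
      by (subst bij_betw_cong[where g = "e \<circ> inv_into P g"]) (auto simp: f_def)
    show "T \<inter> {0..<int (l * M)} = {}" by (auto simp: T_def)
  qed
  then have f: "bij_betw f D (T \<union> {0..<int (l * M)})"
    using WD by (simp add: Un_absorb2)
  have hom: "f (s y) = prolong t (rot (l * M) M) (f y)" if y: "y \<in> D" for y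
  proof (cases "y \<in> W")
    case True
    then obtain p where p: "p \<in> P" "y = g p" by (auto simp: W_def)
    have "0 \<le> e p" by (simp add: e_def split_beta)
    moreover have "f (s y) = e (nxt p)"
      using fg[OF nxt_P[OF p(1)]] by (simp only: p(2) g_nxt[OF p(1)])
    ultimately show ?thesis
      by (simp add: prolong_def e_nxt[OF p(1)] p(2) fg[OF p(1)])
  next
    case False
    then have "y \<in> D - W" "s y \<in> D - W" using y bij_betwE[OF sDW] by blast+
    moreover from this have "h y \<in> T" using bij_betwE[OF h] by blast
    ultimately show ?thesis
      using T(1) by (auto simp: prolong_def f_def t_def bij_betw_inv_into_left[OF h])
  qed
  have "holds D s \<longleftrightarrow> holds (T \<union> {0..<int (l * M)}) (prolong t (rot (l * M) M))"
    using M by (intro holds_conj[OF D bij_betw_prolong[OF t T(1) bij_betw_rot] f hom]) auto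
  with T t card show ?thesis by blast
qed

section \<open>Rotations as direct summands and the absorption of the remaining cycles\<close>

definition K :: nat where "K = 2 ^ qdepth \<phi>"

lemma K_pos: "K > 0"
  by (simp add: K_def)

definition holds_rot :: "int set \<Rightarrow> (int \<Rightarrow> int) \<Rightarrow> nat \<Rightarrow> nat \<Rightarrow> bool" where
  "holds_rot T t n b \<longleftrightarrow> holds (T \<union> {0..<int n}) (prolong t (rot n b))"

lemma holds_rot_resize:
  assumes "T \<subseteq> {..<0}" "bij_betw t T T"
    and "a = a' \<or> (K \<le> a \<and> K \<le> a')" "b = b' \<or> (K \<le> b \<and> K \<le> b')" "b > 0" "b' > 0"
  shows "holds_rot T t (a + b) b \<longleftrightarrow> holds_rot T t (a' + b') b'"
  unfolding holds_rot_def holds_def using assms by (intro models_rot[OF \<phi>]) (simp_all add: K_def)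

text \<open>The two runs have lengths \<open>(l - 1) * M\<close> and \<open>M\<close>, both at least
  \<open>K\<close> because \<open>l \<ge> 2\<close>.\<close>

lemma holds_rot_many_cycles:
  assumes "T \<subseteq> {..<0}" "bij_betw t T T" "l \<ge> 2" "M \<ge> K"
  shows "holds_rot T t (l * M) M \<longleftrightarrow> holds_rot T t (2 * K) K"
proof -
  have "l * M = (l - 1) * M + M" using assms(3) by (cases l) auto
  moreover have "1 * K \<le> (l - 1) * M" using assms(3,4) by (intro mult_le_mono) auto
  moreover have "M > 0" using assms(4) K_pos by simp
  ultimately show ?thesis
    using holds_rot_resize[OF assms(1,2), of "(l - 1) * M" K M K] assms(4) K_pos by (simp add: mult_2)
qed

text \<open>Multiplication by \<open>K\<close>, which is invertible modulo \<open>2 * K + 1\<close>, conjugates the rotation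
  by \<open>1\<close> to the rotation by \<open>K\<close>.\<close>

lemma holds_rot_long_cycle:
  assumes T: "T \<subseteq> {..<0}" "finite T" "bij_betw t T T" and l: "l > K"
  shows "holds_rot T t l 1 \<longleftrightarrow> holds_rot T t (2 * K) K"
proof -
  define n where "n = 2 * K + 1"
  have n: "n > 0" by (simp add: n_def)
  \<comment> \<open>The short run has length 1 on both sides; the long ones, \<open>l - 1\<close>
    and \<open>2 * K\<close>, are at least \<open>K\<close>.\<close>
  have "holds_rot T t ((l - 1) + 1) 1 \<longleftrightarrow> holds_rot T t (2 * K + 1) 1"
    using l by (intro holds_rot_resize T) auto
  then have "holds_rot T t l 1 \<longleftrightarrow> holds_rot T t n 1"
    using l by (simp add: n_def)
  also have "\<dots> \<longleftrightarrow> holds_rot T t n K"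
    unfolding holds_rot_def
  proof (rule holds_conj)
    define f where "f x = (if x < 0 then x else (int K * x) mod int n)" for x
    have "inj_on f {0..<int n}"
    proof (rule inj_onI)
      fix x y assume xy: "x \<in> {0..<int n}" "y \<in> {0..<int n}" "f x = f y"
      then have "int n dvd int K * x - int K * y"
        by (simp add: f_def mod_eq_dvd_iff)
      \<comment> \<open>The inverse of \<open>K\<close> modulo \<open>2 * K + 1\<close> is
        -2.\<close>
      then have "int n dvd int n * (x - y) - 2 * (int K * x - int K * y)"
        by (intro dvd_diff[OF dvd_triv_left dvd_mult])
      also have "int n * (x - y) - 2 * (int K * x - int K * y) = x - y"
        by (simp add: n_def algebra_simps)
      finally have "x mod int n = y mod int n" by (simp add: mod_eq_dvd_iff)
      with xy(1,2) show "x = y" by simp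
    qed
    moreover have "f ` {0..<int n} \<subseteq> {0..<int n}"
      using n by (auto simp: f_def)
    ultimately have "bij_betw f {0..<int n} {0..<int n}"
      by (simp add: bij_betw_def endo_inj_surj)
    moreover have "bij_betw f T T"
      by (subst bij_betw_cong[where g = id]) (use T in \<open>auto simp: f_def\<close>)
    ultimately show "bij_betw f (T \<union> {0..<int n}) (T \<union> {0..<int n})"
      using T(1) by (intro bij_betw_combine) auto
    show "f (prolong t (rot n 1) x) = prolong t (rot n K) (f x)" if x: "x \<in> T \<union> {0..<int n}" for x
    proof (cases "x < 0")
      case True
      then have "t x < 0" using x T bij_betwE[OF T(3)] by auto
      then show ?thesis using True by (simp add: f_def prolong_def)
    next
      case False
      have "(int K * ((x + 1) mod int n)) mod int n = ((int K * x) mod int n + int K) mod int n"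
        by (simp add: mod_simps algebra_simps)
      moreover have "\<not> y mod int n < 0" for y using n by (simp add: not_less)
      ultimately show ?thesis using False by (simp add: f_def prolong_def rot_def)
    qed
  qed (use T n in \<open>auto intro!: bij_betw_prolong bij_betw_rot\<close>)
  also have "\<dots> \<longleftrightarrow> holds_rot T t (2 * K) K"
    using holds_rot_resize[OF T(1,3), of "K + 1" K K K] K_pos by (simp add: n_def mult_2)
  finally show ?thesis .
qed

text \<open>Resize the rotation so that it consists of \<open>K\<close> cycles of length
  \<open>l\<close>, the length of the cycle through \<open>c\<close>. Together with that cycle these
  are \<open>K + 1\<close> cycles, conjugate to a larger rotation, which is resized back. The rest
  has lost \<open>l\<close> points.\<close>

lemma holds_rot_absorb_cycle:
  assumes T: "T \<subseteq> {..<0}" "finite T" "bij_betw t T T" and c: "c \<in> T" "t c \<noteq> c"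
  shows "\<exists>T' t'. T' \<subseteq> {..<0} \<and> finite T' \<and> bij_betw t' T' T' \<and> card T' < card T \<and>
    (holds_rot T t (2 * K) K \<longleftrightarrow> holds_rot T' t' (2 * K) K)"
proof -
  define l where "l = period t c"
  have "l \<noteq> 1" "l > 0"
    using period_eq_1_iff[OF T(3,2) c(1)] period_pos[OF T(3,2) c(1)] c(2) by (auto simp: l_def)
  then have l: "l \<ge> 2" by simp
  define n where "n = l * K"
  define D where "D = T \<union> {0..<int n}"
  define s where "s = prolong t (rot n K)"
  have n: "n > 0" "K \<le> n" using l K_pos by (auto simp: n_def)
  have D: "finite D" "bij_betw s D D"
    using T n by (auto simp: D_def s_def intro!: bij_betw_prolong bij_betw_rot)
  have s_neg: "(s ^^ i) c = (t ^^ i) c" "(t ^^ i) c \<in> T" for i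
  proof (induction i)
    case (Suc i)
    case 1 show ?case using Suc T(1) by (auto simp: s_def prolong_def)
    case 2 show ?case using Suc bij_betwE[OF T(3)] by auto
  qed (use c in auto)
  \<comment> \<open>For \<open>i < l\<close> the iterates of a point below \<open>K\<close> do not
    yet wrap around.\<close>
  have s_nonneg: "(s ^^ i) (int j) = int (i * K + j)" if "j < K" "i < l" for i j
    using that(2)
  proof (induction i)
    case (Suc i)
    have "Suc i * K + j < Suc (Suc i) * K" using that(1) by simp
    also have "\<dots> \<le> l * K" using Suc.prems by (intro mult_le_mono1) simp
    finally have "i * K + j + K < n" by (simp add: n_def)
    then have "int (i * K + j) + int K < int n" by linarith
    moreover have "s y = y + int K" if "0 \<le> y" "y + int K < int n" for y
      using that by (simp add: s_def prolong_def rot_def)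
    ultimately have "s (int (i * K + j)) = int (i * K + j) + int K" by simp
    with Suc show ?case by simp
  qed simp
  \<comment> \<open>Representatives: the points below \<open>K\<close> for the cycles of the
    rotation, and \<open>c\<close> at index \<open>K\<close> for the new one.\<close>
  define x where "x j = (if j < K then int j else c)" for j
  have x_D: "x j \<in> D" if "j < Suc K" for j
    using that c(1) n by (auto simp: x_def D_def)
  have x_per: "(s ^^ l) (x j) = x j" if "j < Suc K" for j
  proof (cases "j < K")
    case True
    have "(s ^^ l) (int j) = s ((s ^^ (l - 1)) (int j))"
      using l by (cases l) auto
    also have "\<dots> = s (int ((l - 1) * K + j))"
      using True l by (simp add: s_nonneg)
    also have "\<dots> = (int ((l - 1) * K + j) + int K) mod int n"
    proof -
      have "s (int k) = (int k + int K) mod int n" for k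
        by (simp add: s_def prolong_def rot_def)
      then show ?thesis .
    qed
    also have "int ((l - 1) * K + j) + int K = int j + int n"
      using l by (cases l) (simp_all add: n_def)
    also have "\<dots> mod int n = int j"
      using True n by simp
    finally show ?thesis using True by (simp add: x_def)
  next
    case False
    then show ?thesis
      using funpow_period[OF T(3,2) c(1)] by (simp add: x_def s_neg(1) l_def)
  qed
  have inj: "inj_on (\<lambda>(i, j). (s ^^ i) (x j)) ({..<l} \<times> {..<Suc K})"
  proof (rule inj_onI; clarify)
    fix i j i' j' assume i: "i < l" "i' < l" and j: "j < Suc K" "j' < Suc K"
      and eq: "(s ^^ i) (x j) = (s ^^ i') (x j')"
    \<comment> \<open>The sign separates the cycles of the rotation from the cycle of
      \<open>c\<close>, which stays in \<open>T\<close>.\<close>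
    have sign: "j < K \<longleftrightarrow> 0 \<le> (s ^^ i) (x j)" if "i < l" for i j
    proof (cases "j < K")
      case True
      then show ?thesis using that by (simp add: x_def s_nonneg)
    next
      case False
      moreover have "(t ^^ i) c < 0" using s_neg(2)[of i] T(1) by auto
      ultimately show ?thesis by (simp add: x_def s_neg(1))
    qed
    then have same: "j < K \<longleftrightarrow> j' < K" using eq i by metis
    show "i = i' \<and> j = j'"
    proof (cases "j < K")
      case True
      then have j': "j' < K" using same by simp
      have "int (i * K + j) = int (i' * K + j')"
        using eq True j' i by (simp only: x_def s_nonneg if_True)
      then have "i * K + j = i' * K + j'" by (simp only: of_nat_eq_iff)
      then have "(i * K + j) div K = (i' * K + j') div K" "(i * K + j) mod K = (i' * K + j') mod K"
        by simp_all
      then show ?thesis using True j' by simp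
    next
      case False
      then have j': "\<not> j' < K" using same by simp
      have "(t ^^ i) c = (t ^^ i') c"
        using eq False j' by (simp only: x_def s_neg(1) if_False)
      then have "i = i'"
        using inj_onD[OF inj_on_funpow_period[OF T(3,2) c(1)], of i i'] i by (simp add: l_def)
      then show ?thesis using j False j' by simp
    qed
  qed
  obtain T' t' where T': "T' \<subseteq> {..<0}" "finite T'" "bij_betw t' T' T'"
    "card T' + l * Suc K = card D" "holds D s \<longleftrightarrow> holds_rot T' t' (l * Suc K) (Suc K)"
    using holds_cycles_iff_rot[OF D zero_less_Suc \<open>l > 0\<close> x_D x_per inj]
    unfolding holds_rot_def by blast
  have "card D = card T + n"
    unfolding D_def using T by (subst card_Un_disjoint) auto
  then have "card T' < card T" using T'(4) l by (simp add: n_def)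
  moreover have "holds_rot T t (2 * K) K \<longleftrightarrow> holds_rot T' t' (2 * K) K"
    using holds_rot_many_cycles[OF T(1,3) l order.refl] holds_rot_many_cycles[OF T'(1,3) l, of "Suc K"] T'(5)
    by (simp add: D_def s_def n_def holds_rot_def)
  ultimately show ?thesis using T'(1-3) by (intro exI[of _ T'] exI[of _ t'] conjI)
qed

text \<open>On the nonnegative part both are involutions of \<open>2 * K\<close> points without
  fixed points, hence conjugate.\<close>

lemma holds_rot_iff_flip:
  assumes T: "T \<subseteq> {..<0}" "finite T" "bij_betw t T T"
  shows "holds_rot T t (2 * K) K \<longleftrightarrow> holds (T \<union> {0..<int (2 * K)}) (prolong t (flip (2 * K)))"
  unfolding holds_rot_def
proof (rule holds_conj)
  \<comment> \<open>Reversing the upper half matches the partner \<open>x + K\<close> of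
    \<open>x < K\<close> with its partner \<open>2 * K - 1 - x\<close> under the reversal.\<close>
  define f where "f x = (if x < int K then x else 3 * int K - 1 - x)" for x
  have "x < int K" if "x \<in> T" for x
  proof -
    have "x < 0" using T(1) that by auto
    then show ?thesis by linarith
  qed
  then have "bij_betw f T T"
    by (subst bij_betw_cong[where g = id]) (auto simp: f_def)
  moreover have "bij_betw f {0..<int (2 * K)} {0..<int (2 * K)}"
    by (rule bij_betw_byWitness[where f' = f]) (auto simp: f_def)
  ultimately show "bij_betw f (T \<union> {0..<int (2 * K)}) (T \<union> {0..<int (2 * K)})"
    using T(1) by (intro bij_betw_combine) auto
  show "f (prolong t (rot (2 * K) K) x) = prolong t (flip (2 * K)) (f x)"
    if x: "x \<in> T \<union> {0..<int (2 * K)}" for x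
  proof (cases "x < 0")
    case True
    then have "t x < 0" using x T bij_betwE[OF T(3)] by auto
    then have "t x < int K" "x < int K" using True by linarith+
    then show ?thesis using True by (simp add: f_def prolong_def)
  next
    case False
    with x T(1) have "0 \<le> x" "x < int (K + K)" by auto
    then have "rot (2 * K) K x = (if x < int K then x + int K else x - int K)"
      unfolding mult_2 using K_pos by (rule rot_add)
    with False \<open>x < int (K + K)\<close> show ?thesis
      by (simp add: f_def prolong_def flip_def)
  qed
qed (use T(2) in simp, rule bij_betw_prolong[OF T(3,1) bij_betw_rot], use K_pos in simp,
    rule bij_betw_prolong[OF T(3,1) bij_betw_flip])

text \<open>A reversal of even size has no fixed point, a reversal of odd size has one.\<close>

lemma holds_rot_absorb_fixed_point:
  assumes T: "T \<subseteq> {..<0}" "finite T" "bij_betw t T T" and c: "c \<in> T" "t c = c"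
  shows "bij_betw t (T - {c}) (T - {c})"
    and "holds_rot T t (2 * K) K \<longleftrightarrow> holds_rot (T - {c}) t (2 * K) K"
proof -
  define T' where "T' = T - {c}"
  have "bij_betw t {c} {c}" using c by (simp add: bij_betw_def)
  then have T': "T' \<subseteq> {..<0}" "finite T'" "bij_betw t T' T'"
    unfolding T'_def using T c bij_betw_DiffI[OF T(3)] by auto
  then show "bij_betw t (T - {c}) (T - {c})" by (simp add: T'_def)
  have "holds (T \<union> {0..<int (2 * K)}) (prolong t (flip (2 * K))) \<longleftrightarrow>
    holds (T' \<union> {0..<int (2 * K + 1)}) (prolong t (flip (2 * K + 1)))"
  proof (rule holds_conj)
    \<comment> \<open>The fixed point \<open>c\<close> becomes the centre \<open>K\<close> of the
      longer reversal, and the upper half moves up by one to make room.\<close>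
    define f where "f x = (if x = c then int K else if x < int K then x else x + 1)" for x
    have neg: "c < 0" "\<And>x. x \<in> T \<Longrightarrow> x < 0" using T(1) c by auto
    show "bij_betw f (T \<union> {0..<int (2 * K)}) (T' \<union> {0..<int (2 * K + 1)})"
      by (rule bij_betw_byWitness[where
            f' = "\<lambda>x. if x = int K then c else if x < int K then x else x - 1"])
        (use neg c(1) in \<open>auto simp: f_def T'_def split: if_splits dest: neg(2)\<close>)
    show "f (prolong t (flip (2 * K)) x) = prolong t (flip (2 * K + 1)) (f x)"
      if x: "x \<in> T \<union> {0..<int (2 * K)}" for x
    proof (cases "x < 0")
      case True
      then have "x \<in> T" "t x < 0" using x T bij_betwE[OF T(3)] by auto
      moreover have "t x = c \<longleftrightarrow> x = c"
        using c T(3) \<open>x \<in> T\<close> by (metis bij_betw_imp_inj_on inj_onD)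
      ultimately show ?thesis using True c(2) by (auto simp: f_def prolong_def flip_def)
    next
      case False
      then show ?thesis using x neg by (auto simp: f_def prolong_def flip_def)
    qed
  qed (use T(2) in simp, rule bij_betw_prolong[OF T(3,1) bij_betw_flip],
      rule bij_betw_prolong[OF T'(3,1) bij_betw_flip])
  also have "\<dots> \<longleftrightarrow> holds (T' \<union> {0..<int (2 * K)}) (prolong t (flip (2 * K)))"
    unfolding holds_def using T' by (intro models_flip \<phi>) (auto simp: K_def)
  finally show "holds_rot T t (2 * K) K \<longleftrightarrow> holds_rot (T - {c}) t (2 * K) K"
    using holds_rot_iff_flip[OF T] holds_rot_iff_flip[OF T'] by (simp add: T'_def)
qed

text \<open>Induction on the number of points outside the rotation: as long as there are any, the
  cycle through one of them, possibly a fixed point, is absorbed.\<close>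

lemma holds_rot_absorb:
  assumes "T \<subseteq> {..<0}" "finite T" "bij_betw t T T"
  shows "holds_rot T t (2 * K) K \<longleftrightarrow> holds_rot {} id (2 * K) K"
  using assms
proof (induction "card T" arbitrary: T t rule: less_induct)
  case less
  show ?case
  proof (cases "T = {}")
    case True
    \<comment> \<open>With \<open>T\<close> empty, \<open>prolong\<close> never consults its first
      argument, so \<open>t\<close> may be replaced by \<open>id\<close>.\<close>
    have *: "bij_betw (prolong u (rot (2 * K) K)) ({} \<union> {0..<int (2 * K)}) ({} \<union> {0..<int (2 * K)})"
      for u
      by (intro bij_betw_prolong bij_betw_rot) (use K_pos in \<open>simp_all add: bij_betw_def\<close>)
    have "holds_rot {} t (2 * K) K \<longleftrightarrow> holds_rot {} id (2 * K) K"
      unfolding holds_rot_def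
      by (rule holds_conj[OF _ * *, where f = id]) (auto simp: prolong_def)
    then show ?thesis using True by simp
  next
    case False
    then obtain c where c: "c \<in> T" by blast
    show ?thesis
    proof (cases "t c = c")
      case True
      have "card (T - {c}) < card T" using less.prems(2) c by (rule card_Diff1_less)
      then show ?thesis
        using less.hyps[of "T - {c}" t] holds_rot_absorb_fixed_point[OF less.prems c True] less.prems
        by auto
    next
      case False
      then obtain T' t' where "T' \<subseteq> {..<0}" "finite T'" "bij_betw t' T' T'" "card T' < card T"
        and "holds_rot T t (2 * K) K \<longleftrightarrow> holds_rot T' t' (2 * K) K"
        using holds_rot_absorb_cycle[OF less.prems c] by auto
      then show ?thesis using less.hyps[of T' t'] by simp
    qed
  qed
qed

text \<open>Pigeonhole: either some cycle is longer than \<open>K\<close>, or the lengths of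
  nontrivial cycles lie in \<open>{2..K}\<close>. In the second case, if every such length
  \<open>l\<close> had fewer than \<open>l * K\<close> points, the support would have at most
  \<open>K * (K * K)\<close> points.\<close>

lemma holds_of_large_support:
  assumes D: "finite D" "bij_betw s D D" and large: "K * (K * K) < card {x \<in> D. s x \<noteq> x}"
  shows "holds D s \<longleftrightarrow> holds_rot {} id (2 * K) K"
proof (cases "\<exists>x\<in>D. period s x > K")
  case True
  then obtain x where x: "x \<in> D" "period s x > K" by blast
  let ?l = "period s x"
  have "inj_on (\<lambda>(i, j). (s ^^ i) x) ({..<?l} \<times> {..<1::nat})"
    using inj_on_funpow_period[OF D(2,1) x(1)] by (auto simp: inj_on_def)
  then obtain T t where T: "T \<subseteq> {..<0}" "finite T" "bij_betw t T T"
    and "holds D s \<longleftrightarrow> holds_rot T t ?l 1"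
    using holds_cycles_iff_rot[OF D, of 1 ?l "\<lambda>_. x"] x funpow_period[OF D(2,1) x(1)]
      period_pos[OF D(2,1) x(1)]
    unfolding holds_rot_def by auto
  then show ?thesis
    using holds_rot_long_cycle[OF T x(2)] holds_rot_absorb[OF T] by simp
next
  case False
  have "\<exists>l\<in>{2..K}. l * K \<le> card {x \<in> D. period s x = l}"
  proof (rule ccontr)
    assume few: "\<not> ?thesis"
    have "{x \<in> D. s x \<noteq> x} \<subseteq> (\<Union>l\<in>{2..K}. {x \<in> D. period s x = l})"
    proof clarify
      fix x assume x: "x \<in> D" "s x \<noteq> x"
      then have "period s x \<noteq> 1" "period s x > 0" "period s x \<le> K"
        using period_eq_1_iff[OF D(2,1)] period_pos[OF D(2,1)] False by auto
      then show "x \<in> (\<Union>l\<in>{2..K}. {x \<in> D. period s x = l})" using x(1) by auto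
    qed
    then have "card {x \<in> D. s x \<noteq> x} \<le> card (\<Union>l\<in>{2..K}. {x \<in> D. period s x = l})"
      using D(1) by (intro card_mono) auto
    also have "\<dots> \<le> (\<Sum>l\<in>{2..K}. card {x \<in> D. period s x = l})"
      by (rule card_UN_le) simp
    also have "\<dots> \<le> (\<Sum>l\<in>{2..K}. K * K)"
    proof (rule sum_mono)
      fix l assume l: "l \<in> {2..K}"
      then have "\<not> l * K \<le> card {x \<in> D. period s x = l}" using few by blast
      then have "card {x \<in> D. period s x = l} \<le> l * K" by simp
      also have "\<dots> \<le> K * K" using l by (intro mult_le_mono1) simp
      finally show "card {x \<in> D. period s x = l} \<le> K * K" .
    qed
    also have "\<dots> = (Suc K - 2) * (K * K)" by simp
    also have "\<dots> \<le> K * (K * K)" by (intro mult_le_mono1) simp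
    finally show False using large by simp
  qed
  then obtain l where l: "2 \<le> l" "l * K \<le> card {x \<in> D. period s x = l}" by auto
  then obtain x where x: "\<And>j. j < K \<Longrightarrow> x j \<in> D \<and> period s (x j) = l"
    and inj: "inj_on (\<lambda>(i, j). (s ^^ i) (x j)) ({..<l} \<times> {..<K})"
    using ex_cycle_representatives[OF D(2,1), of l K] by auto
  have "x j \<in> D" "(s ^^ l) (x j) = x j" if "j < K" for j
    using x[OF that] funpow_period[OF D(2,1), of "x j"] by auto
  then obtain T t where T: "T \<subseteq> {..<0}" "finite T" "bij_betw t T T"
    and "holds D s \<longleftrightarrow> holds_rot T t (l * K) K"
    using holds_cycles_iff_rot[OF D K_pos _ _ _ inj] l(1) unfolding holds_rot_def by auto
  then show ?thesis
    using holds_rot_many_cycles[OF T(1,3) l(1) order.refl] holds_rot_absorb[OF T] by simp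
qed

lemma toto_models_of_large_support:
  assumes \<sigma>: "(n, \<sigma>) \<in> perms" and large: "K * (K * K) < card (perm_support (n, \<sigma>))"
  shows "(n, \<sigma>) \<in> toto_models \<phi> \<longleftrightarrow> holds_rot {} id (2 * K) K"
proof -
  define s where "s = int \<circ> (\<sigma> \<circ> nat)"
  define D where "D = int ` {1..n}"
  have int: "bij_betw int {1..n} D" by (simp add: D_def bij_betw_def)
  have nat: "bij_betw nat D {1..n}" by (rule bij_betw_byWitness[where f' = int]) (auto simp: D_def)
  have "bij_betw \<sigma> {1..n} {1..n}"
    using \<sigma> by (simp add: perms_def permutes_imp_bij)
  then have s: "bij_betw s D D"
    unfolding s_def by (rule bij_betw_trans[OF bij_betw_trans[OF nat] int])
  have "{x \<in> D. s x \<noteq> x} = int ` perm_support (n, \<sigma>)"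
    by (auto simp: D_def s_def perm_support_def)
  then have "K * (K * K) < card {x \<in> D. s x \<noteq> x}"
    using large by (simp add: card_image)
  moreover have "(n, \<sigma>) \<in> toto_models \<phi> \<longleftrightarrow> holds D s"
    unfolding holds_def
    by (rule toto_models_transfer[OF \<phi> \<sigma> int]) (auto simp: s_def strict_mono_on_def)
  ultimately show ?thesis
    using holds_of_large_support[OF _ s] by (simp add: D_def)
qed

end

section \<open>Conjugation invariance from the second definition, and the dichotomy\<close>

lemma toob_models_conj:
  assumes \<psi>: "sentence \<psi>" and perms: "(n, \<sigma>) \<in> perms" "(n, \<tau>) \<in> perms"
    and f: "bij_betw f {1..n} {1..n}" "\<And>i. i \<in> {1..n} \<Longrightarrow> f (\<sigma> i) = \<tau> (f i)"
  shows "(n, \<sigma>) \<in> toob_models \<psi> \<longleftrightarrow> (n, \<tau>) \<in> toob_models \<psi>"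
proof -
  have "models {1..n} (toob_interp (n, \<sigma>)) \<psi> \<longleftrightarrow> models {1..n} (toob_interp (n, \<tau>)) \<psi>"
  proof (rule models_isomorphic[OF \<psi> f(1)])
    fix r i j assume i: "i \<in> {1..n}" and j: "j \<in> {1..n}"
    have "\<sigma> i \<in> {1..n}"
      using perms(1) i by (simp add: perms_def permutes_in_image del: atLeastAtMost_iff)
    then have "\<sigma> i = j \<longleftrightarrow> f (\<sigma> i) = f j"
      using j bij_betw_imp_inj_on[OF f(1)] by (metis inj_onD)
    then show "toob_interp (n, \<sigma>) r i j \<longleftrightarrow> toob_interp (n, \<tau>) r (f i) (f j)"
      using f(2)[OF i] by (cases r) simp
  qed
  then show ?thesis using perms by (simp add: toob_models_def toob_dom_def)
qed

theorem theorem6p2: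
  fixes E :: "sized_perm set"
  assumes "to_toto_toob_set E"
  shows "(\<exists>N. \<forall>\<pi>\<in>perms. card (perm_support \<pi>) \<ge> N \<longrightarrow> \<pi> \<in> E) \<or>
         (\<exists>B. \<forall>\<pi>\<in>E. card (perm_support \<pi>) \<le> B)"
proof -
  obtain \<phi> \<psi> where \<phi>: "sentence \<phi>" and \<psi>: "sentence \<psi>"
    and toto: "toto_models \<phi> = E" and toob: "toob_models \<psi> = E"
    using assms unfolding to_toto_toob_set_def by blast
  interpret conj_invariant_toto \<phi>
  proof
    fix n \<sigma> \<tau> f
    assume "(n, \<sigma>) \<in> perms" "(n, \<tau>) \<in> perms" "bij_betw f {1..n} {1..n}"
      "\<And>i. i \<in> {1..n} \<Longrightarrow> f (\<sigma> i) = \<tau> (f i)"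
    from toob_models_conj[OF \<psi> this]
    show "(n, \<sigma>) \<in> toto_models \<phi> \<longleftrightarrow> (n, \<tau>) \<in> toto_models \<phi>"
      by (simp add: toto toob)
  qed fact
  let ?N = "K * (K * K)"
  \<comment> \<open>The right-hand side does not mention \<open>\<pi>\<close>: beyond the threshold,
    membership in \<open>E\<close> is one fixed truth value, and its two possibilities give the two
    alternatives.\<close>
  have *: "\<pi> \<in> E \<longleftrightarrow> holds_rot {} id (2 * K) K"
    if "\<pi> \<in> perms" "?N < card (perm_support \<pi>)" for \<pi>
    using toto_models_of_large_support[of "fst \<pi>" "snd \<pi>"] that toto by simp
  have "E \<subseteq> perms" using toto by (auto simp: toto_models_def)
  show ?thesis
  proof (cases "holds_rot {} id (2 * K) K")
    case True
    then have "\<forall>\<pi>\<in>perms. card (perm_support \<pi>) \<ge> Suc ?N \<longrightarrow> \<pi> \<in> E" using * by simp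
    then show ?thesis by blast
  next
    case False
    then have "\<forall>\<pi>\<in>E. card (perm_support \<pi>) \<le> ?N"
      using * \<open>E \<subseteq> perms\<close> by (meson not_less subsetD)
    then show ?thesis by blast
  qed
qed

end
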